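(* Let the data model density belong to the exponential family, i.e. $$p(x\mid\theta)=h(x)\,\exp\{\eta(\theta)^{T} T(x)\}\,g(\eta(\theta)),$$ where $\eta(\theta)=(\eta_1(\theta),\dots,\eta_s(\theta))$ is the vector of natural parameters, $T(x)=(T_1(x),\dots,T_s(x))$, and the support of the density does not depend on $\theta$. Let $$L(\theta;x_{1:n})=\prod_{k=1}^n p(x_k\mid\theta)$$ be the likelihood of $n$ independent and identically distributed observations. Then the likelihood-induced priors on $\theta$ are the densities of the form $$q(\theta)\ \propto\ \sqrt{\det \mathcal I(\theta)}\; g(\eta(\theta))^{\gamma}\,\exp\{\eta(\theta)^{T}\lambda\},\qquad \gamma\in\mathbb R,\ \lambda\in\mathbb R^s,$$ for which the right-hand side is normalizable, where $\mathcal I(\theta)$ is the Fisher information matrix of the data model. Moreover, this family of priors is conjugate to the likelihood $L$: if the prior is a member of this family, then the posterior density of $\theta$ given $x_{1:n}$, which is proportional to $L(\theta;x_{1:n})\,q(\theta)$, is again a member of this family.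
   Context: The parameter $\theta$ ranges over an open subset $\Omega$ of a Euclidean space, $x\mapsto p(x\mid\theta)$ is a probability density for each $\theta\in\Omega$, with $h\ge 0$ and $g(\eta(\theta))>0$, and the usual regularity conditions ensuring that the Fisher information matrix $$\mathcal I(\theta)_{ij}=\int \frac{\partial \ln p(x\mid\theta)}{\partial\theta_i}\,\frac{\partial \ln p(x\mid\theta)}{\partial\theta_j}\,p(x\mid\theta)\,dx$$ is well defined hold. All integrals involved are assumed to be finite; in particular the evidence $\int_\Omega L(\theta;x_{1:n})\,q(\theta)\,d\theta$ is assumed to be positive and finite for the data $x_{1:n}$ considered. The likelihood-induced prior is defined by the following four-step construction. 1. Form the average log-likelihood $l(\theta;x_{1:n})=\frac1n\ln L(\theta;x_{1:n})$ for pseudo-observations $x_{1:n}$ (their numerical values are irrelevant). 2. Coarse-grain: take the expectation $\langle\cdot\rangle$ of $l$ with respect to a distribution $p(\theta\mid x_{1:n})$ of $\theta$. The conservation laws are the functions $f_1(\theta),\dots,f_r(\theta)$ whose expectations $\langle f_k\rangle$ appear in the result, i.e. the functions of $\theta$ in the expansion of $l$ as a function of the data alone plus a linear combination of the $f_k(\theta)$ with data-dependent (or constant) coefficients. In the exponential-family case $$\langle l\rangle=\frac1n\sum_{k=1}^n\ln h(x_k)+\langle\ln g(\eta)\rangle+\langle\eta\rangle^{T}\,\frac1n\sum_{k=1}^n T(x_k),$$ so the conservation laws are $\ln g(\eta(\theta))$ and the components $\eta_1(\theta),\dots,\eta_s(\theta)$. 3. Take the Jeffreys prior $m(\theta)\propto\sqrt{\det\mathcal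 I(\theta)}$ of the data model as the reference density (the state of maximum uncertainty). It need not be normalizable. 4. A likelihood-induced prior is a maximum entropy density relative to $m$ with these conservation laws, i.e. a probability density of the form $$q(\theta)=\frac{m(\theta)}{Z(\lambda_1,\dots,\lambda_r)}\exp\Big(-\sum_{k=1}^r\lambda_k f_k(\theta)\Big),$$ where $\lambda_1,\dots,\lambda_r$ are real numbers and $Z(\lambda_1,\dots,\lambda_r)$ is the (finite) normalization constant. A family of priors is called conjugate to a likelihood if for every prior in the family the corresponding posterior also belongs to the family. *)

theory Defs
  imports "HOL-Probability.Probability"
begin

text \<open>
  A data model is a function \<open>p x \<theta>\<close> of an observation \<open>x\<close> and a parameter
  \<open>\<theta> \<in> \<Omega> \<subseteq> real ^ 'd\<close>; densities of \<open>x\<close> are taken with respect to a dominating measure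
  \<open>M\<close> (for instance \<open>lborel\<close>, so that integration against \<open>M\<close> is \<open>dx\<close>), densities of \<open>\<theta>\<close> with
  respect to Lebesgue measure on \<open>\<Omega>\<close>.  Data \<open>x\<^sub>1, \<dots>, x\<^sub>n\<close> are a list of length \<open>n\<close>.
\<close>

subsection \<open>Data models\<close>

definition statistical_model :: "'x measure \<Rightarrow> (real ^ 'd) set \<Rightarrow> ('x \<Rightarrow> real ^ 'd \<Rightarrow> real) \<Rightarrow> bool"
  where "statistical_model M \<Omega> p \<longleftrightarrow>
    open \<Omega> \<and>
    (\<forall>\<theta>\<in>\<Omega>. (\<lambda>x. p x \<theta>) \<in> borel_measurable M \<and> (\<forall>x\<in>space M. 0 \<le> p x \<theta>) \<and>
       (\<integral>\<^sup>+x. ennreal (p x \<theta>) \<partial>M) = 1)"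

definition common_support ::
    "'x measure \<Rightarrow> (real ^ 'd) set \<Rightarrow> ('x \<Rightarrow> real ^ 'd \<Rightarrow> real) \<Rightarrow> 'x set \<Rightarrow> bool"
  where "common_support M \<Omega> p S \<longleftrightarrow> (\<forall>\<theta>\<in>\<Omega>. {x \<in> space M. p x \<theta> > 0} = S)"

definition exponential_family ::
    "'x measure \<Rightarrow> (real ^ 'd) set \<Rightarrow> ('x \<Rightarrow> real ^ 'd \<Rightarrow> real) \<Rightarrow>
     ('x \<Rightarrow> real) \<Rightarrow> ('x \<Rightarrow> real ^ 's) \<Rightarrow> (real ^ 'd \<Rightarrow> real ^ 's) \<Rightarrow> (real ^ 's \<Rightarrow> real) \<Rightarrow> bool"
  where "exponential_family M \<Omega> p h T \<eta> g \<longleftrightarrow>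
    (\<forall>x\<in>space M. 0 \<le> h x) \<and> (\<forall>\<theta>\<in>\<Omega>. 0 < g (\<eta> \<theta>)) \<and>
    (\<forall>x\<in>space M. \<forall>\<theta>\<in>\<Omega>. p x \<theta> = h x * exp (\<eta> \<theta> \<bullet> T x) * g (\<eta> \<theta>))"

definition likelihood :: "('x \<Rightarrow> 'p \<Rightarrow> real) \<Rightarrow> 'x list \<Rightarrow> 'p \<Rightarrow> real"
  where "likelihood p xs \<theta> = (\<Prod>x\<leftarrow>xs. p x \<theta>)"

definition avg_loglik :: "('x \<Rightarrow> 'p \<Rightarrow> real) \<Rightarrow> 'x list \<Rightarrow> 'p \<Rightarrow> real"
  where "avg_loglik p xs \<theta> = ln (likelihood p xs \<theta>) / real (length xs)"


subsection \<open>Fisher information and the Jeffreys prior\<close>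

definition score :: "('x \<Rightarrow> real ^ 'd \<Rightarrow> real) \<Rightarrow> 'x \<Rightarrow> real ^ 'd \<Rightarrow> 'd \<Rightarrow> real"
  where "score p x \<theta> i = deriv (\<lambda>t. ln (p x (\<theta> + t *\<^sub>R axis i 1))) 0"

definition fisher_information ::
    "'x measure \<Rightarrow> ('x \<Rightarrow> real ^ 'd \<Rightarrow> real) \<Rightarrow> real ^ 'd \<Rightarrow> real ^ 'd ^ 'd"
  where "fisher_information M p \<theta> =
    (\<chi> i j. \<integral>x. score p x \<theta> i * score p x \<theta> j * p x \<theta> \<partial>M)"

definition fisher_regular ::
    "'x measure \<Rightarrow> (real ^ 'd) set \<Rightarrow> ('x \<Rightarrow> real ^ 'd \<Rightarrow> real) \<Rightarrow> 'x set \<Rightarrow> bool"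
  where "fisher_regular M \<Omega> p S \<longleftrightarrow>
    (\<forall>\<theta>\<in>\<Omega>.
       (\<forall>i. AE x in M. x \<in> S \<longrightarrow> (\<lambda>t. ln (p x (\<theta> + t *\<^sub>R axis i 1))) differentiable (at 0)) \<and>
       (\<forall>i j. integrable M (\<lambda>x. score p x \<theta> i * score p x \<theta> j * p x \<theta>)))"

definition jeffreys_prior ::
    "'x measure \<Rightarrow> (real ^ 'd) set \<Rightarrow> ('x \<Rightarrow> real ^ 'd \<Rightarrow> real) \<Rightarrow> (real ^ 'd \<Rightarrow> real) \<Rightarrow> bool"
  where "jeffreys_prior M \<Omega> p m \<longleftrightarrow>
    (\<exists>C>0. \<forall>\<theta>\<in>\<Omega>. m \<theta> = C * sqrt (det (fisher_information M p \<theta>)))"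


subsection \<open>Densities of the parameter\<close>

definition prob_density_on :: "(real ^ 'd) set \<Rightarrow> (real ^ 'd \<Rightarrow> real) \<Rightarrow> bool"
  where "prob_density_on \<Omega> q \<longleftrightarrow>
    (\<forall>\<theta>\<in>\<Omega>. 0 \<le> q \<theta>) \<and> set_integrable lborel \<Omega> q \<and> (LINT \<theta>:\<Omega>|lborel. q \<theta>) = 1"

definition normalizable_on :: "(real ^ 'd) set \<Rightarrow> (real ^ 'd \<Rightarrow> real) \<Rightarrow> bool"
  where "normalizable_on \<Omega> w \<longleftrightarrow> set_integrable lborel \<Omega> w \<and> 0 < (LINT \<theta>:\<Omega>|lborel. w \<theta>)"

definition density_proportional_to ::
    "(real ^ 'd) set \<Rightarrow> (real ^ 'd \<Rightarrow> real) \<Rightarrow> (real ^ 'd \<Rightarrow> real) \<Rightarrow> bool"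
  where "density_proportional_to \<Omega> q w \<longleftrightarrow>
    normalizable_on \<Omega> w \<and> prob_density_on \<Omega> q \<and> (\<exists>C>0. \<forall>\<theta>\<in>\<Omega>. q \<theta> = C * w \<theta>)"


subsection \<open>Likelihood-induced priors\<close>

text \<open>
  The functions \<open>f k\<close> are the conservation laws read off from the expansion of the average
  log-likelihood with data part \<open>a\<close> and coefficients \<open>c\<close>, both pointwise and after
  coarse-graining with an arbitrary distribution \<open>P\<close> of the parameter.  The expansion is an
  argument because the functions \<open>f k\<close> are not determined by the likelihood alone: terms may
  be split or regrouped.  Pseudo-observations are taken in the support, where the logarithm of the
  likelihood is finite.
\<close>

definition conservation_laws ::
    "(real ^ 'd) set \<Rightarrow> ('x \<Rightarrow> real ^ 'd \<Rightarrow> real) \<Rightarrow> 'x set \<Rightarrow>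
     ('x list \<Rightarrow> real) \<Rightarrow> ('x list \<Rightarrow> 'k::finite \<Rightarrow> real) \<Rightarrow> ('k \<Rightarrow> real ^ 'd \<Rightarrow> real) \<Rightarrow> bool"
  where "conservation_laws \<Omega> p S a c f \<longleftrightarrow>
    (\<forall>xs. xs \<noteq> [] \<and> set xs \<subseteq> S \<longrightarrow>
       (\<forall>\<theta>\<in>\<Omega>. avg_loglik p xs \<theta> = a xs + (\<Sum>k\<in>UNIV. c xs k * f k \<theta>)) \<and>
       (\<forall>P. prob_space P \<and> sets P = sets (restrict_space borel \<Omega>) \<and> (\<forall>k. integrable P (f k)) \<longrightarrow>
          (\<integral>\<theta>. avg_loglik p xs \<theta> \<partial>P) = a xs + (\<Sum>k\<in>UNIV. c xs k * (\<integral>\<theta>. f k \<theta> \<partial>P))))"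

definition max_entropy_density ::
    "(real ^ 'd) set \<Rightarrow> (real ^ 'd \<Rightarrow> real) \<Rightarrow> ('k::finite \<Rightarrow> real ^ 'd \<Rightarrow> real) \<Rightarrow>
     (real ^ 'd \<Rightarrow> real) \<Rightarrow> bool"
  where "max_entropy_density \<Omega> m f q \<longleftrightarrow>
    prob_density_on \<Omega> q \<and>
    (\<exists>\<mu> :: 'k \<Rightarrow> real.
       let w = (\<lambda>\<theta>. m \<theta> * exp (- (\<Sum>k\<in>UNIV. \<mu> k * f k \<theta>)));
           Z = (LINT \<theta>:\<Omega>|lborel. w \<theta>)
       in normalizable_on \<Omega> w \<and>
          (\<forall>\<theta>\<in>\<Omega>. q \<theta> = m \<theta> / Z * exp (- (\<Sum>k\<in>UNIV. \<mu> k * f k \<theta>))))"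

definition likelihood_induced_prior ::
    "'x measure \<Rightarrow> (real ^ 'd) set \<Rightarrow> ('x \<Rightarrow> real ^ 'd \<Rightarrow> real) \<Rightarrow> 'x set \<Rightarrow>
     ('x list \<Rightarrow> real) \<Rightarrow> ('x list \<Rightarrow> 'k::finite \<Rightarrow> real) \<Rightarrow> ('k \<Rightarrow> real ^ 'd \<Rightarrow> real) \<Rightarrow>
     (real ^ 'd \<Rightarrow> real) \<Rightarrow> bool"
  where "likelihood_induced_prior M \<Omega> p S a c f q \<longleftrightarrow>
    conservation_laws \<Omega> p S a c f \<and>
    (\<exists>m. jeffreys_prior M \<Omega> p m \<and> max_entropy_density \<Omega> m f q)"


subsection \<open>The expansion for an exponential family\<close>

text \<open>
  The conservation laws are indexed by \<open>'s option\<close>: \<open>None\<close> stands for \<open>ln g(\<eta>(\<theta>))\<close>, \<open>Some i\<close>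
  for \<open>\<eta>\<^sub>i(\<theta>)\<close>.
\<close>

definition expfam_data_part :: "('x \<Rightarrow> real) \<Rightarrow> 'x list \<Rightarrow> real"
  where "expfam_data_part h xs = (\<Sum>x\<leftarrow>xs. ln (h x)) / real (length xs)"

definition expfam_coeff :: "('x \<Rightarrow> real ^ 's) \<Rightarrow> 'x list \<Rightarrow> 's option \<Rightarrow> real"
  where "expfam_coeff T xs k =
    (case k of None \<Rightarrow> 1 | Some i \<Rightarrow> (\<Sum>x\<leftarrow>xs. T x $ i) / real (length xs))"

definition expfam_law ::
    "(real ^ 'd \<Rightarrow> real ^ 's) \<Rightarrow> (real ^ 's \<Rightarrow> real) \<Rightarrow> 's option \<Rightarrow> real ^ 'd \<Rightarrow> real"
  where "expfam_law \<eta> g k \<theta> = (case k of None \<Rightarrow> ln (g (\<eta> \<theta>)) | Some i \<Rightarrow> \<eta> \<theta> $ i)"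


definition expfam_priors ::
    "'x measure \<Rightarrow> (real ^ 'd) set \<Rightarrow> ('x \<Rightarrow> real ^ 'd \<Rightarrow> real) \<Rightarrow>
     (real ^ 'd \<Rightarrow> real ^ 's) \<Rightarrow> (real ^ 's \<Rightarrow> real) \<Rightarrow> (real ^ 'd \<Rightarrow> real) set"
  where "expfam_priors M \<Omega> p \<eta> g =
    {q. \<exists>(\<gamma> :: real) (v :: real ^ 's). density_proportional_to \<Omega> q
       (\<lambda>\<theta>. sqrt (det (fisher_information M p \<theta>)) * g (\<eta> \<theta>) powr \<gamma> * exp (\<eta> \<theta> \<bullet> v))}"


subsection \<open>Conjugacy\<close>

definition posterior ::
    "(real ^ 'd) set \<Rightarrow> ('x \<Rightarrow> real ^ 'd \<Rightarrow> real) \<Rightarrow> (real ^ 'd \<Rightarrow> real) \<Rightarrow> 'x list \<Rightarrow> real ^ 'd \<Rightarrow> real"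
  where "posterior \<Omega> p q xs \<theta> =
    likelihood p xs \<theta> * q \<theta> / (LINT \<theta>:\<Omega>|lborel. likelihood p xs \<theta> * q \<theta>)"

text \<open>The posterior is only considered for data whose evidence is positive and finite.\<close>

definition conjugate_family ::
    "'x measure \<Rightarrow> (real ^ 'd) set \<Rightarrow> ('x \<Rightarrow> real ^ 'd \<Rightarrow> real) \<Rightarrow> (real ^ 'd \<Rightarrow> real) set \<Rightarrow> bool"
  where "conjugate_family M \<Omega> p F \<longleftrightarrow>
    (\<forall>q\<in>F. \<forall>xs. xs \<noteq> [] \<and> set xs \<subseteq> space M \<and>
       normalizable_on \<Omega> (\<lambda>\<theta>. likelihood p xs \<theta> * q \<theta>) \<longrightarrow> posterior \<Omega> p q xs \<in> F)"

end

theory Submission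
  imports Defs
begin

text \<open>For \<open>n\<close> observations the likelihood factors as \<open>H *
  g(\<eta>(\<theta>)) powr n * exp (\<eta>(\<theta>) \<bullet> t)\<close>, where \<open>H\<close> is
  the product of the values of \<open>h\<close> and \<open>t\<close> the sum of the values of
  \<open>T\<close> (\<open>likelihood_exponential_family\<close>). Both claims are read off from
  this.

  Its logarithm is affine in \<open>ln g(\<eta>)\<close> and the \<open>\<eta>\<^sub>i\<close>, so
  these are conservation laws, and averaging over a distribution of \<theta> is linearity of the
  integral. Exponentiating minus a linear combination of them gives
  \<open>g(\<eta>) powr \<gamma> * exp (\<eta> \<bullet> v)\<close>, with \<gamma> and the entries
  of \<open>v\<close> the negated multipliers (\<open>exp_expfam_laws\<close>). Hence maximum
  entropy densities relative to the Jeffreys prior and members of the family agree up to positive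
  constants, which normalization fixes (\<open>max_entropy_density_iff\<close>).

  Multiplying a member by the likelihood moves \<open>(\<gamma>, v)\<close> to
  \<open>(\<gamma> + n, v + t)\<close>, which is conjugacy
  (\<open>conjugate_expfam_priors\<close>).\<close>

lemma set_integral_scaled:
  fixes w w' :: "'a \<Rightarrow> real"
  assumes "\<And>\<theta>. \<theta> \<in> \<Omega> \<Longrightarrow> w' \<theta> = C * w \<theta>"
  shows "(LINT \<theta>:\<Omega>|N. w' \<theta>) = C * (LINT \<theta>:\<Omega>|N. w \<theta>)"
proof -
  have "(\<lambda>\<theta>. indicator \<Omega> \<theta> *\<^sub>R w' \<theta>) = (\<lambda>\<theta>. C * (indicator \<Omega> \<theta> *\<^sub>R w \<theta>))"
    using assms by (auto simp: indicator_def)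
  then show ?thesis
    unfolding set_lebesgue_integral_def by simp
qed

lemma set_integrable_scaled:
  fixes w w' :: "'a \<Rightarrow> real"
  assumes "set_integrable N \<Omega> w" and "\<And>\<theta>. \<theta> \<in> \<Omega> \<Longrightarrow> w' \<theta> = C * w \<theta>"
  shows "set_integrable N \<Omega> w'"
proof -
  have "(\<lambda>\<theta>. indicator \<Omega> \<theta> *\<^sub>R w' \<theta>) = (\<lambda>\<theta>. C * (indicator \<Omega> \<theta> *\<^sub>R w \<theta>))"
    using assms(2) by (auto simp: indicator_def)
  then show ?thesis
    using assms(1) unfolding set_integrable_def by simp
qed

lemma normalizable_on_scaled:
  assumes "normalizable_on \<Omega> w" and "C > 0" and "\<And>\<theta>. \<theta> \<in> \<Omega> \<Longrightarrow> w' \<theta> = C * w \<theta>"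
  shows "normalizable_on \<Omega> w'"
  using assms set_integrable_scaled[of lborel \<Omega> w w' C] set_integral_scaled[of \<Omega> w' C w lborel]
  by (simp add: normalizable_on_def)

text \<open>Total mass one determines the factor \<open>C\<close>. This turns "proportional to
  \<open>w\<close>" into the form with an explicit normalization constant \<open>Z\<close>.\<close>

lemma proportional_density_eq_normalized:
  assumes "prob_density_on \<Omega> q" and "\<And>\<theta>. \<theta> \<in> \<Omega> \<Longrightarrow> q \<theta> = C * w \<theta>" and "\<theta> \<in> \<Omega>"
  shows "q \<theta> = w \<theta> / (LINT \<theta>:\<Omega>|lborel. w \<theta>)"
proof -
  have "C * (LINT \<theta>:\<Omega>|lborel. w \<theta>) = 1"
    using assms(1) set_integral_scaled[of \<Omega> q C w lborel] assms(2)
    by (simp add: prob_density_on_def)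
  \<comment> \<open>The product being 1 rules out a zero integral, so the division is
    genuine.\<close>
  then have "C = 1 / (LINT \<theta>:\<Omega>|lborel. w \<theta>)"
    by (metis mult_zero_right nonzero_eq_divide_eq zero_neq_one)
  then show ?thesis using assms(2,3) by simp
qed

text \<open>Factorization through the sufficient statistic. The exponent is written with
  \<open>powr\<close> so that it can later be added to a real \<gamma>. Data range over all of
  \<open>space M\<close>, so the factor from \<open>h\<close> may vanish.\<close>

lemma likelihood_exponential_family:
  assumes "exponential_family M \<Omega> p h T \<eta> g" and "set xs \<subseteq> space M" and "\<theta> \<in> \<Omega>"
  shows "likelihood p xs \<theta> =
    (\<Prod>x\<leftarrow>xs. h x) * g (\<eta> \<theta>) powr real (length xs) * exp (\<eta> \<theta> \<bullet> (\<Sum>x\<leftarrow>xs. T x))"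
  using assms(2)
proof (induction xs)
  case Nil
  \<comment> \<open>\<open>0 powr 0\<close> is 0, so positivity of \<open>g\<close> is what makes
    the empty product 1.\<close>
  then show ?case using assms(1,3) by (auto simp: likelihood_def exponential_family_def)
next
  case (Cons x xs)
  have g: "0 < g (\<eta> \<theta>)" and px: "p x \<theta> = h x * exp (\<eta> \<theta> \<bullet> T x) * g (\<eta> \<theta>)"
    using assms(1,3) Cons.prems by (auto simp: exponential_family_def)
  have "likelihood p (x # xs) \<theta> = p x \<theta> * likelihood p xs \<theta>"
    by (simp add: likelihood_def)
  then show ?case
    using Cons g by (simp add: px powr_add inner_add_right exp_add)
qed

lemma avg_loglik_exponential_family:
  fixes T :: "'x \<Rightarrow> real ^ 's"
  assumes ef: "exponential_family M \<Omega> p h T \<eta> g"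
    and xs: "xs \<noteq> []" "set xs \<subseteq> space M" "\<And>x. x \<in> set xs \<Longrightarrow> 0 < h x"
    and \<theta>: "\<theta> \<in> \<Omega>"
  shows "avg_loglik p xs \<theta> =
    expfam_data_part h xs + (\<Sum>k\<in>UNIV. expfam_coeff T xs k * expfam_law \<eta> g k \<theta>)"
proof -
  have g: "0 < g (\<eta> \<theta>)"
    using ef \<theta> by (auto simp: exponential_family_def)
  \<comment> \<open>Positivity is carried through the induction together with the identity, since
    splitting the logarithm needs the remaining product to be positive.\<close>
  have h: "0 < (\<Prod>x\<leftarrow>xs. h x) \<and> ln (\<Prod>x\<leftarrow>xs. h x) = (\<Sum>x\<leftarrow>xs. ln (h x))"
    using xs(3)
  proof (induction xs)
    case (Cons x xs)
    then have "0 < h x" by simp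
    with Cons show ?case by (simp add: ln_mult_pos)
  qed simp
  have comp: "(\<Sum>x\<leftarrow>xs. T x) $ i = (\<Sum>x\<leftarrow>xs. T x $ i)" for i
    by (induction xs) auto
  have "ln (likelihood p xs \<theta>) = (\<Sum>x\<leftarrow>xs. ln (h x)) + real (length xs) * ln (g (\<eta> \<theta>))
      + \<eta> \<theta> \<bullet> (\<Sum>x\<leftarrow>xs. T x)"
    using g h by (simp add: likelihood_exponential_family[OF ef xs(2) \<theta>] ln_mult ln_powr)
  also have "\<eta> \<theta> \<bullet> (\<Sum>x\<leftarrow>xs. T x) = (\<Sum>i\<in>UNIV. (\<Sum>x\<leftarrow>xs. T x $ i) * \<eta> \<theta> $ i)"
    by (simp add: inner_vec_def comp mult.commute)
  finally show ?thesis
    \<comment> \<open>For nonempty data, dividing by the length turns the multiple of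
      \<open>ln g\<close> into the coefficient 1 at \<open>None\<close>.\<close>
    using xs(1)
    by (simp add: avg_loglik_def expfam_data_part_def expfam_coeff_def expfam_law_def
        UNIV_option_conv sum.reindex add_divide_distrib sum_divide_distrib)
qed

lemma conservation_laws_exponential_family:
  assumes ef: "exponential_family M \<Omega> p h T \<eta> g" and cs: "common_support M \<Omega> p S"
  shows "conservation_laws \<Omega> p S (expfam_data_part h) (expfam_coeff T) (expfam_law \<eta> g)"
proof -
  have expansion: "avg_loglik p xs \<theta> =
      expfam_data_part h xs + (\<Sum>k\<in>UNIV. expfam_coeff T xs k * expfam_law \<eta> g k \<theta>)"
    if xs: "xs \<noteq> []" "set xs \<subseteq> S" and \<theta>: "\<theta> \<in> \<Omega>" for xs \<theta>
  proof -
    have S: "S = {x \<in> space M. p x \<theta> > 0}"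
      using cs \<theta> by (auto simp: common_support_def)
    \<comment> \<open>On the support the density is positive, which excludes \<open>h x = 0\<close>;
      this makes the logarithmic expansion available.\<close>
    have "0 < h x" if "x \<in> set xs" for x
    proof -
      have "x \<in> space M" "0 < p x \<theta>" using that xs S by auto
      then have "0 < h x * exp (\<eta> \<theta> \<bullet> T x) * g (\<eta> \<theta>)" "0 \<le> h x"
        using ef \<theta> by (auto simp: exponential_family_def)
      then show ?thesis by (cases "h x = 0") auto
    qed
    then show ?thesis
      using avg_loglik_exponential_family[OF ef _ _ _ \<theta>] xs S by auto
  qed
  have "(\<integral>\<theta>. avg_loglik p xs \<theta> \<partial>P) = expfam_data_part h xs +
      (\<Sum>k\<in>UNIV. expfam_coeff T xs k * (\<integral>\<theta>. expfam_law \<eta> g k \<theta> \<partial>P))"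
    if xs: "xs \<noteq> []" "set xs \<subseteq> S" and P: "prob_space P" "sets P = sets (restrict_space borel \<Omega>)"
      and int: "\<And>k. integrable P (expfam_law \<eta> g k)" for xs P
  proof -
    interpret prob_space P by (rule P(1))
    have sp: "space P = \<Omega>"
      using sets_eq_imp_space_eq[OF P(2)] by (simp add: space_restrict_space)
    have "(\<integral>\<theta>. avg_loglik p xs \<theta> \<partial>P) =
        (\<integral>\<theta>. expfam_data_part h xs + (\<Sum>k\<in>UNIV. expfam_coeff T xs k * expfam_law \<eta> g k \<theta>) \<partial>P)"
      using expansion[OF xs] sp by (intro Bochner_Integration.integral_cong) auto
    \<comment> \<open>Linearity of the integral; the data part is constant in \<theta> and
      \<open>P\<close> has mass one.\<close>
    also have "\<dots> = expfam_data_part h xs +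
        (\<Sum>k\<in>UNIV. expfam_coeff T xs k * (\<integral>\<theta>. expfam_law \<eta> g k \<theta> \<partial>P))"
      using int by (simp add: prob_space)
    finally show ?thesis .
  qed
  with expansion show ?thesis
    unfolding conservation_laws_def by blast
qed

text \<open>Dictionary between Lagrange multipliers and the parameters of the family: the multiplier
  of \<open>ln g\<close> becomes a power of \<open>g\<close>, and both change sign.\<close>

lemma exp_expfam_laws:
  fixes \<eta> :: "real ^ 'd \<Rightarrow> real ^ 's"
  assumes "0 < g (\<eta> \<theta>)"
  shows "exp (- (\<Sum>k\<in>UNIV. \<mu> k * expfam_law \<eta> g k \<theta>)) =
    g (\<eta> \<theta>) powr (- \<mu> None) * exp (\<eta> \<theta> \<bullet> (\<chi> i. - \<mu> (Some i)))"
proof -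
  have "(\<Sum>k\<in>UNIV. \<mu> k * expfam_law \<eta> g k \<theta>) =
      \<mu> None * ln (g (\<eta> \<theta>)) - \<eta> \<theta> \<bullet> (\<chi> i. - \<mu> (Some i))"
    by (simp add: UNIV_option_conv sum.reindex expfam_law_def inner_vec_def sum_negf mult.commute)
  then show ?thesis
    using assms by (simp add: powr_def exp_add[symmetric])
qed

text \<open>The two parametrizations match by a sign change. The Jeffreys prior is fixed only up to
  a positive factor, which is absorbed into the proportionality constant.\<close>

lemma max_entropy_density_iff:
  assumes g: "\<And>\<theta>. \<theta> \<in> \<Omega> \<Longrightarrow> 0 < g (\<eta> \<theta>)"
  shows "(\<exists>m. jeffreys_prior M \<Omega> p m \<and> max_entropy_density \<Omega> m (expfam_law \<eta> g) q) \<longleftrightarrow>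
    q \<in> expfam_priors M \<Omega> p \<eta> g"
proof
  assume "\<exists>m. jeffreys_prior M \<Omega> p m \<and> max_entropy_density \<Omega> m (expfam_law \<eta> g) q"
  then obtain m \<mu> C where C: "C > 0" "\<And>\<theta>. \<theta> \<in> \<Omega> \<Longrightarrow> m \<theta> = C * sqrt (det (fisher_information M p \<theta>))"
    and q: "prob_density_on \<Omega> q"
    and n: "normalizable_on \<Omega> (\<lambda>\<theta>. m \<theta> * exp (- (\<Sum>k\<in>UNIV. \<mu> k * expfam_law \<eta> g k \<theta>)))"
    and qe: "\<And>\<theta>. \<theta> \<in> \<Omega> \<Longrightarrow> q \<theta> =
      m \<theta> / (LINT \<theta>:\<Omega>|lborel. m \<theta> * exp (- (\<Sum>k\<in>UNIV. \<mu> k * expfam_law \<eta> g k \<theta>))) *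
      exp (- (\<Sum>k\<in>UNIV. \<mu> k * expfam_law \<eta> g k \<theta>))"
    unfolding jeffreys_prior_def max_entropy_density_def Let_def by blast
  let ?w = "\<lambda>\<theta>. m \<theta> * exp (- (\<Sum>k\<in>UNIV. \<mu> k * expfam_law \<eta> g k \<theta>))"
  let ?v = "(\<chi> i. - \<mu> (Some i)) :: real ^ 'b"
  let ?u = "\<lambda>\<theta>. sqrt (det (fisher_information M p \<theta>)) * g (\<eta> \<theta>) powr (- \<mu> None) * exp (\<eta> \<theta> \<bullet> ?v)"
  have w: "?w \<theta> = C * ?u \<theta>" if "\<theta> \<in> \<Omega>" for \<theta>
    using that C(2) exp_expfam_laws[of g \<eta> \<theta> \<mu>, OF g] by simp
  have Z: "(LINT \<theta>:\<Omega>|lborel. ?w \<theta>) > 0" using n by (simp add: normalizable_on_def)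
  have "normalizable_on \<Omega> ?u"
  proof (rule normalizable_on_scaled[OF n])
    show "1 / C > 0" using C(1) by simp
    show "?u \<theta> = 1 / C * ?w \<theta>" if "\<theta> \<in> \<Omega>" for \<theta>
      unfolding w[OF that] using C(1) by simp
  qed
  moreover have "q \<theta> = C / (LINT \<theta>:\<Omega>|lborel. ?w \<theta>) * ?u \<theta>" if "\<theta> \<in> \<Omega>" for \<theta>
    using qe[OF that] w[OF that] by simp
  ultimately have "density_proportional_to \<Omega> q ?u"
    unfolding density_proportional_to_def using q C(1) Z by (meson divide_pos_pos)
  then show "q \<in> expfam_priors M \<Omega> p \<eta> g"
    unfolding expfam_priors_def by blast
next
  let ?J = "\<lambda>\<theta>. sqrt (det (fisher_information M p \<theta>))"
  assume "q \<in> expfam_priors M \<Omega> p \<eta> g"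
  then obtain \<gamma> v C
    where n: "normalizable_on \<Omega> (\<lambda>\<theta>. ?J \<theta> * g (\<eta> \<theta>) powr \<gamma> * exp (\<eta> \<theta> \<bullet> v))"
      and q: "prob_density_on \<Omega> q"
      and C: "C > 0" "\<And>\<theta>. \<theta> \<in> \<Omega> \<Longrightarrow> q \<theta> = C * (?J \<theta> * g (\<eta> \<theta>) powr \<gamma> * exp (\<eta> \<theta> \<bullet> v))"
    unfolding expfam_priors_def density_proportional_to_def by blast
  let ?u = "\<lambda>\<theta>. ?J \<theta> * g (\<eta> \<theta>) powr \<gamma> * exp (\<eta> \<theta> \<bullet> v)"
  \<comment> \<open>Multipliers inverse to the dictionary, so that the Gibbs weight
    \<open>?w\<close> equals \<open>?u\<close> on \<Omega>.\<close>
  define \<mu> where "\<mu> k = (case k of None \<Rightarrow> - \<gamma> | Some i \<Rightarrow> - v $ i)" for k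
  let ?w = "\<lambda>\<theta>. ?J \<theta> * exp (- (\<Sum>k\<in>UNIV. \<mu> k * expfam_law \<eta> g k \<theta>))"
  have w: "?w \<theta> = ?u \<theta>" if "\<theta> \<in> \<Omega>" for \<theta>
    using exp_expfam_laws[of g \<eta> \<theta> \<mu>, OF g[OF that]] by (simp add: \<mu>_def)
  have "normalizable_on \<Omega> ?w"
    by (rule normalizable_on_scaled[OF n, of 1]) (use w in auto)
  moreover have "q \<theta> = ?J \<theta> / (LINT \<theta>:\<Omega>|lborel. ?w \<theta>) *
      exp (- (\<Sum>k\<in>UNIV. \<mu> k * expfam_law \<eta> g k \<theta>))" if "\<theta> \<in> \<Omega>" for \<theta>
  proof -
    have "q \<theta> = C * ?w \<theta>" if "\<theta> \<in> \<Omega>" for \<theta>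
      unfolding w[OF that] by (rule C(2)[OF that])
    from proportional_density_eq_normalized[OF q this that] show ?thesis by simp
  qed
  ultimately have "max_entropy_density \<Omega> ?J (expfam_law \<eta> g) q"
    unfolding max_entropy_density_def Let_def using q by blast
  \<comment> \<open>The representative with constant 1 serves as reference density.\<close>
  moreover have "jeffreys_prior M \<Omega> p ?J"
    unfolding jeffreys_prior_def by (intro exI[of _ 1]) simp
  ultimately show "\<exists>m. jeffreys_prior M \<Omega> p m \<and> max_entropy_density \<Omega> m (expfam_law \<eta> g) q"
    by blast
qed

lemma prob_density_on_posterior:
  assumes "normalizable_on \<Omega> (\<lambda>\<theta>. likelihood p xs \<theta> * q \<theta>)"
    and "\<And>\<theta>. \<theta> \<in> \<Omega> \<Longrightarrow> 0 \<le> likelihood p xs \<theta>" and "prob_density_on \<Omega> q"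
  shows "prob_density_on \<Omega> (posterior \<Omega> p q xs)"
proof -
  define E where "E = (LINT \<theta>:\<Omega>|lborel. likelihood p xs \<theta> * q \<theta>)"
  have E: "E > 0" and i: "set_integrable lborel \<Omega> (\<lambda>\<theta>. likelihood p xs \<theta> * q \<theta>)"
    using assms(1) by (auto simp: normalizable_on_def E_def)
  have eq: "posterior \<Omega> p q xs \<theta> = 1 / E * (likelihood p xs \<theta> * q \<theta>)" for \<theta>
    by (simp add: posterior_def E_def)
  have "set_integrable lborel \<Omega> (posterior \<Omega> p q xs)"
    by (rule set_integrable_scaled[OF i eq])
  moreover have "(LINT \<theta>:\<Omega>|lborel. posterior \<Omega> p q xs \<theta>) = 1"
    using set_integral_scaled[of \<Omega> "posterior \<Omega> p q xs" _ _ lborel, OF eq] E by (simp add: E_def)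
  moreover have "0 \<le> posterior \<Omega> p q xs \<theta>" if "\<theta> \<in> \<Omega>" for \<theta>
    using assms(2,3) that E by (simp add: eq prob_density_on_def)
  ultimately show ?thesis by (simp add: prob_density_on_def)
qed

text \<open>The posterior kernel is that of the prior with \<gamma> raised by the number of
  observations and \<open>v\<close> shifted by the sum of the sufficient statistics.\<close>

lemma conjugate_expfam_priors:
  assumes ef: "exponential_family M \<Omega> p h T \<eta> g"
  shows "conjugate_family M \<Omega> p (expfam_priors M \<Omega> p \<eta> g)"
  unfolding conjugate_family_def
proof (intro ballI allI impI)
  fix q xs
  let ?J = "\<lambda>\<theta>. sqrt (det (fisher_information M p \<theta>))"
  assume "q \<in> expfam_priors M \<Omega> p \<eta> g"
  then obtain \<gamma> v C where q: "prob_density_on \<Omega> q" and C: "C > 0"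
    "\<And>\<theta>. \<theta> \<in> \<Omega> \<Longrightarrow> q \<theta> = C * (?J \<theta> * g (\<eta> \<theta>) powr \<gamma> * exp (\<eta> \<theta> \<bullet> v))"
    unfolding expfam_priors_def density_proportional_to_def by blast
  assume "xs \<noteq> [] \<and> set xs \<subseteq> space M \<and> normalizable_on \<Omega> (\<lambda>\<theta>. likelihood p xs \<theta> * q \<theta>)"
  then have xs: "set xs \<subseteq> space M" and n: "normalizable_on \<Omega> (\<lambda>\<theta>. likelihood p xs \<theta> * q \<theta>)"
    by auto
  define H where "H = (\<Prod>x\<leftarrow>xs. h x)"
  define E where "E = (LINT \<theta>:\<Omega>|lborel. likelihood p xs \<theta> * q \<theta>)"
  define w where "w \<theta> = ?J \<theta> * g (\<eta> \<theta>) powr (\<gamma> + real (length xs)) *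
    exp (\<eta> \<theta> \<bullet> (v + (\<Sum>x\<leftarrow>xs. T x)))" for \<theta>
  note L = likelihood_exponential_family[OF ef xs, folded H_def]
  have "\<forall>x\<in>set xs. 0 \<le> h x" using ef xs by (auto simp: exponential_family_def)
  then have H0: "0 \<le> H" unfolding H_def by (induction xs) auto
  have E: "E > 0" using n by (simp add: normalizable_on_def E_def)
  have Lq: "likelihood p xs \<theta> * q \<theta> = H * C * w \<theta>" if "\<theta> \<in> \<Omega>" for \<theta>
    using L[OF that] C(2)[OF that]
    by (simp add: w_def powr_add inner_add_right exp_add)
  \<comment> \<open>If some \<open>h x\<close> vanished, the likelihood would be identically zero, and so would the evidence.\<close>
  have "H \<noteq> 0"
    using E set_integral_scaled[of \<Omega> _ "H * C" w lborel, OF Lq] by (auto simp: E_def)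
  with H0 have H: "H > 0" by simp
  \<comment> \<open>On \<Omega> the evidence integrand is \<open>H * C\<close> times
    \<open>w\<close>, so the positive finite evidence makes the updated kernel normalizable.\<close>
  have "normalizable_on \<Omega> w"
    by (rule normalizable_on_scaled[OF n, of "1 / (H * C)"]) (use H C Lq in auto)
  moreover have "prob_density_on \<Omega> (posterior \<Omega> p q xs)"
    using L H0 by (intro prob_density_on_posterior[OF n _ q]) auto
  moreover have "posterior \<Omega> p q xs \<theta> = H * C / E * w \<theta>" if "\<theta> \<in> \<Omega>" for \<theta>
    using Lq[OF that] by (simp add: posterior_def E_def)
  moreover have "H * C / E > 0" using H C E by simp
  ultimately have "density_proportional_to \<Omega> (posterior \<Omega> p q xs) w"
    unfolding density_proportional_to_def by blast
  then show "posterior \<Omega> p q xs \<in> expfam_priors M \<Omega> p \<eta> g"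
    unfolding expfam_priors_def w_def by blast
qed

theorem mainTheorem1:
  fixes M :: "'x measure"
    and \<Omega> :: "(real ^ 'd) set"
    and p :: "'x \<Rightarrow> real ^ 'd \<Rightarrow> real"
    and S :: "'x set"
    and h :: "'x \<Rightarrow> real"
    and T :: "'x \<Rightarrow> real ^ 's"
    and \<eta> :: "real ^ 'd \<Rightarrow> real ^ 's"
    and g :: "real ^ 's \<Rightarrow> real"
  assumes "statistical_model M \<Omega> p"
    and "exponential_family M \<Omega> p h T \<eta> g"
    and "common_support M \<Omega> p S"
    and "fisher_regular M \<Omega> p S"
  shows "conservation_laws \<Omega> p S (expfam_data_part h) (expfam_coeff T) (expfam_law \<eta> g) \<and>
         (\<forall>q. likelihood_induced_prior M \<Omega> p S
                (expfam_data_part h) (expfam_coeff T) (expfam_law \<eta> g) q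
              \<longleftrightarrow> q \<in> expfam_priors M \<Omega> p \<eta> g) \<and>
         conjugate_family M \<Omega> p (expfam_priors M \<Omega> p \<eta> g)"
  using conservation_laws_exponential_family[OF assms(2,3)]
    max_entropy_density_iff[of \<Omega> g \<eta> M p] conjugate_expfam_priors[OF assms(2)] assms(2)
  by (auto simp: likelihood_induced_prior_def exponential_family_def)

end
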